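(* Let $n\ge2$ and let $X$ be a uniform random point on $\sqrt n\,S^{n-1}$, the sphere in $\mathbb{R}^n$ of radius $\sqrt n$ centered at the origin. For $\theta\in S^{n-1}$ (a unit vector of $\mathbb{R}^n$), define $W=\langle X,\theta\rangle$. Then $$d_{TV}(W,Z)\le\frac{2\sqrt2}{\sqrt{(n-1)(n+2)}}\,,$$ where $Z$ is a standard Gaussian $N(0,1)$ random variable.
   Context: The total variation distance between random variables $X$ and $Y$ is $d_{TV}(X,Y)=\frac12\sup_g|\mathbb{E}g(X)-\mathbb{E}g(Y)|$, the supremum being over continuous functions $g$ bounded by $1$ in absolute value. *)

theory Defs
  imports "HOL-Probability.Probability"
begin

text \<open>
  The uniform distribution on the sphere of radius \<open>r\<close> about the origin is the normalized
  surface measure. We use its cone description: the normalized surface measure of a Borel set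
  \<open>A\<close> of unit vectors is the proportion of the volume of the unit ball lying over \<open>A\<close>,
  so the measure is the image of the uniform distribution on the ball under radial projection.
  The value of the projection at the origin is irrelevant. The lemmas below record the
  properties that determine this measure uniquely: it is a Borel probability measure,
  concentrated on the sphere and invariant under orthogonal transformations.
\<close>

definition uniform_sphere :: "real \<Rightarrow> 'a::euclidean_space measure" where
  "uniform_sphere r = distr (uniform_measure lborel (ball 0 1)) borel (\<lambda>x. r *\<^sub>R sgn x)"

text \<open>
  The random variables may live on different probability spaces, since the total variation
  distance depends only on their distributions.
\<close>

definition dTV :: "'a measure \<Rightarrow> ('a \<Rightarrow> real) \<Rightarrow> 'b measure \<Rightarrow> ('b \<Rightarrow> real) \<Rightarrow> real" where
  "dTV M X N Y =
     (1 / 2) * (SUP g \<in> {g :: real \<Rightarrow> real. continuous_on UNIV g \<and> (\<forall>x. \<bar>g x\<bar> \<le> 1)}.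
        \<bar>(\<integral>\<omega>. g (X \<omega>) \<partial>M) - (\<integral>\<omega>. g (Y \<omega>) \<partial>N)\<bar>)"

text \<open>The supremum is over a nonempty bounded set, so it is a genuine one.\<close>

lemma dTV_bdd_above:
  assumes "prob_space M" "prob_space N"
  shows "bdd_above ((\<lambda>g. \<bar>(\<integral>\<omega>. g (X \<omega>) \<partial>M) - (\<integral>\<omega>. g (Y \<omega>) \<partial>N)\<bar>) `
           {g :: real \<Rightarrow> real. continuous_on UNIV g \<and> (\<forall>x. \<bar>g x\<bar> \<le> 1)})"
proof -
  have b: "\<bar>\<integral>\<omega>. f \<omega> \<partial>L\<bar> \<le> 1"
    if L: "prob_space L" and f: "\<And>\<omega>. \<bar>f \<omega> :: real\<bar> \<le> 1" for L :: "'c measure" and f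
  proof (cases "integrable L f")
    case True
    interpret prob_space L by (rule L)
    have "\<bar>\<integral>\<omega>. f \<omega> \<partial>L\<bar> \<le> (\<integral>\<omega>. \<bar>f \<omega>\<bar> \<partial>L)"
      by (rule integral_abs_bound)
    also have "\<dots> \<le> (\<integral>\<omega>. 1 \<partial>L)"
      using True f by (intro integral_mono) auto
    finally show ?thesis by (simp add: prob_space)
  qed (simp add: not_integrable_integral_eq)
  show ?thesis
  proof (rule bdd_aboveI2[where M = 2])
    fix g :: "real \<Rightarrow> real"
    assume "g \<in> {g. continuous_on UNIV g \<and> (\<forall>x. \<bar>g x\<bar> \<le> 1)}"
    then have "\<bar>\<integral>\<omega>. g (X \<omega>) \<partial>M\<bar> \<le> 1" "\<bar>\<integral>\<omega>. g (Y \<omega>) \<partial>N\<bar> \<le> 1"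
      using b[OF assms(1), of "\<lambda>\<omega>. g (X \<omega>)"] b[OF assms(2), of "\<lambda>\<omega>. g (Y \<omega>)"] by auto
    then show "\<bar>(\<integral>\<omega>. g (X \<omega>) \<partial>M) - (\<integral>\<omega>. g (Y \<omega>) \<partial>N)\<bar> \<le> 2" by linarith
  qed
qed

lemma emeasure_unit_ball:
  "emeasure lborel (ball 0 1 :: 'a::euclidean_space set) \<noteq> 0"
  "emeasure lborel (ball 0 1 :: 'a::euclidean_space set) \<noteq> \<infinity>"
proof -
  show "emeasure lborel (ball 0 1 :: 'a set) \<noteq> \<infinity>"
    by (metis emeasure_bounded_finite bounded_ball infinity_ennreal_def less_irrefl)
  have "ball 0 1 \<notin> null_sets (lborel :: 'a measure)"
  proof
    assume "ball 0 1 \<in> null_sets (lborel :: 'a measure)"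
    then have "negligible (ball 0 1 :: 'a set)"
      by (simp add: negligible_iff_null_sets null_sets_completionI)
    then show False
      using open_not_negligible[of "ball 0 1 :: 'a set"] by simp
  qed
  then show "emeasure lborel (ball 0 1 :: 'a set) \<noteq> 0"
    by (auto simp: null_sets_def)
qed

lemma measurable_scaled_sgn [measurable]:
  "(\<lambda>x. r *\<^sub>R sgn x) \<in> borel_measurable (borel :: 'a::euclidean_space measure)"
  unfolding sgn_div_norm by measurable

lemma sets_uniform_sphere [simp, measurable_cong]: "sets (uniform_sphere r) = sets borel"
  by (simp add: uniform_sphere_def)

lemma prob_space_uniform_sphere: "prob_space (uniform_sphere r)"
  unfolding uniform_sphere_def
  by (intro prob_space.prob_space_distr prob_space_uniform_measure emeasure_unit_ball) simp

lemma AE_uniform_sphere: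
  assumes "r \<ge> 0"
  shows "AE x in (uniform_sphere r :: 'a::euclidean_space measure). x \<in> sphere 0 r"
proof -
  have "AE x in lborel. x \<noteq> (0 :: 'a)"
    by (rule AE_lborel_singleton)
  then have "AE x in uniform_measure lborel (ball 0 1). r *\<^sub>R sgn (x :: 'a) \<in> sphere 0 r"
  proof (intro AE_uniform_measureI)
    assume "AE x in lborel. x \<noteq> (0 :: 'a)"
    then show "AE x in lborel. x \<in> ball 0 1 \<longrightarrow> r *\<^sub>R sgn (x :: 'a) \<in> sphere 0 r"
      by (rule eventually_mono) (use assms in \<open>simp add: norm_sgn\<close>)
  qed simp
  then show ?thesis
    unfolding uniform_sphere_def by (subst AE_distr_iff) auto
qed

lemma emeasure_open_le_orthogonal_vimage:
  fixes T :: "'a::euclidean_space \<Rightarrow> 'a"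
  assumes T: "orthogonal_transformation T" and U: "open U"
  shows "emeasure lborel U \<le> emeasure lborel (T -` U)"
proof -
  have lin: "linear T" using T by (rule orthogonal_transformation_linear)
  have bij: "bij T" using T by (rule orthogonal_transformation_bij)
  have contT: "continuous_on UNIV T"
    using lin by (intro linear_continuous_on) (simp add: linear_linear)
  have TU: "open (T -` U)" using contT U by (simp add: open_vimage)
  have vb: "T -` ball c r = ball (inv T c) r" for c r
  proof -
    have "dist (inv T c) x = dist c (T x)" for x
    proof -
      have "dist c (T x) = norm (T (inv T c - x))"
        using bij by (simp add: linear_diff[OF lin] dist_norm surj_f_inv_f bij_is_surj)
      then show ?thesis
        using T by (simp add: orthogonal_transformation_norm dist_norm)
    qed
    then show ?thesis by auto
  qed
  define K where "K = {(c, r). 0 < r \<and> ball c r \<subseteq> U}"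
  obtain C where C: "countable C" "C \<subseteq> K"
     "pairwise (\<lambda>i j. disjnt (ball (fst i) (snd i)) (ball (fst j) (snd j))) C"
     "negligible (U - (\<Union>i\<in>C. ball (fst i) (snd i)))"
  proof (rule Vitali_covering_theorem_balls[of U K fst snd])
    fix x d assume "x \<in> U" "(0 :: real) < d"
    obtain e where e: "e > 0" "ball x e \<subseteq> U" using U \<open>x \<in> U\<close> openE by blast
    have "ball x (min e (d / 2)) \<subseteq> U" using e(2) by (auto simp: subset_iff)
    then have "(x, min e (d / 2)) \<in> K" using e(1) \<open>0 < d\<close> by (simp add: K_def)
    then show "\<exists>i. i \<in> K \<and> x \<in> ball (fst i) (snd i) \<and> snd i < d"
      using e(1) \<open>0 < d\<close> by (intro exI[of _ "(x, min e (d / 2))"]) auto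
  qed
  let ?B = "\<lambda>i. ball (fst i) (snd i)"
  have BU: "(\<Union>i\<in>C. ?B i) \<subseteq> U" using C(2) by (force simp: K_def)
  have oB: "open (\<Union>i\<in>C. ?B i)" by auto
  have N: "U - (\<Union>i\<in>C. ?B i) \<in> null_sets lborel"
    using C(4) U oB by (simp add: negligible_iff_null_sets null_sets_completion_iff)
  have "emeasure lborel U = emeasure lborel ((\<Union>i\<in>C. ?B i) \<union> (U - (\<Union>i\<in>C. ?B i)))"
    using BU by (simp add: Un_absorb1)
  also have "\<dots> = emeasure lborel (\<Union>i\<in>C. ?B i)"
    using N oB by (intro emeasure_Un_null_set) auto
  also have "\<dots> = (\<integral>\<^sup>+i. emeasure lborel (?B i) \<partial>count_space C)"
    using C(1,3) by (intro emeasure_UN_countable)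
      (auto simp: disjoint_family_on_def pairwise_def disjnt_def)
  also have "\<dots> = (\<integral>\<^sup>+i. emeasure lborel (T -` ?B i) \<partial>count_space C)"
    using C(2) by (intro nn_integral_cong) (auto simp: vb K_def emeasure_ball)
  also have "\<dots> = emeasure lborel (\<Union>i\<in>C. T -` ?B i)"
  proof (rule emeasure_UN_countable[symmetric])
    have "disjoint_family_on ?B C"
      using C(3) by (auto simp: disjoint_family_on_def pairwise_def disjnt_def)
    then show "disjoint_family_on (\<lambda>i. T -` ?B i) C"
      unfolding disjoint_family_on_def by (metis vimage_Int vimage_empty)
  qed (use C(1) in \<open>auto simp: vb\<close>)
  also have "\<dots> \<le> emeasure lborel (T -` U)"
    using BU TU by (intro emeasure_mono) auto
  finally show ?thesis .
qed

lemma measurable_orthogonal_transformation: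
  fixes T :: "'a::euclidean_space \<Rightarrow> 'a"
  assumes "orthogonal_transformation T"
  shows "T \<in> borel_measurable borel"
  using orthogonal_transformation_linear[OF assms]
  by (intro borel_measurable_continuous_onI linear_continuous_on) (simp add: linear_linear)

lemma lborel_distr_orthogonal_transformation:
  fixes T :: "'a::euclidean_space \<Rightarrow> 'a"
  assumes T: "orthogonal_transformation T"
  shows "distr lborel borel T = lborel"
proof (rule lborel_eqI[symmetric])
  fix l u :: 'a
  assume lu: "\<And>b. b \<in> Basis \<Longrightarrow> l \<bullet> b \<le> u \<bullet> b"
  note Tm [measurable] = measurable_orthogonal_transformation[OF T]
  have "open (T -` box l u)"
    using orthogonal_transformation_linear[OF T]
    by (intro open_vimage linear_continuous_on) (auto simp: linear_linear)
  then have "emeasure lborel (T -` box l u) \<le> emeasure lborel (inv T -` T -` box l u)"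
    by (intro emeasure_open_le_orthogonal_vimage orthogonal_transformation_inv T)
  also have "inv T -` T -` box l u = box l u"
    using orthogonal_transformation_surj[OF T] by (auto simp: surj_f_inv_f)
  finally have "emeasure lborel (T -` box l u) = emeasure lborel (box l u)"
    using emeasure_open_le_orthogonal_vimage[OF T, of "box l u"] by (simp add: open_box)
  then show "emeasure (distr lborel borel T) (box l u) = (\<Prod>b\<in>Basis. (u - l) \<bullet> b)"
    using lu by (simp add: emeasure_distr)
qed simp

lemma uniform_sphere_rotation_invariant:
  fixes T :: "'a::euclidean_space \<Rightarrow> 'a"
  assumes T: "orthogonal_transformation T"
  shows "distr (uniform_sphere r) borel T = uniform_sphere r"
proof -
  let ?U = "uniform_measure lborel (ball 0 1 :: 'a set)"
  have lin: "linear T" using T by (rule orthogonal_transformation_linear)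
  note Tm [measurable] = measurable_orthogonal_transformation[OF T]
  have sgnT: "T (r *\<^sub>R sgn x) = r *\<^sub>R sgn (T x)" for x
    using lin T by (simp add: sgn_div_norm linear_scale orthogonal_transformation_norm)
  have inv: "distr ?U borel T = ?U"
  proof (rule measure_eqI)
    fix A assume "A \<in> sets (distr ?U borel T)"
    then have [measurable]: "A \<in> sets borel" by simp
    have TA: "T -` A \<in> sets borel"
      using measurable_sets[OF Tm, of A] by simp
    have "ball 0 1 \<inter> T -` A = T -` (ball 0 1 \<inter> A)"
      using T by (auto simp: orthogonal_transformation_norm)
    then have "emeasure lborel (ball 0 1 \<inter> T -` A) = emeasure (distr lborel borel T) (ball 0 1 \<inter> A)"
      by (simp add: emeasure_distr)
    also have "\<dots> = emeasure lborel (ball 0 1 \<inter> A)"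
      by (simp add: lborel_distr_orthogonal_transformation[OF T])
    finally show "emeasure (distr ?U borel T) A = emeasure ?U A"
      using TA by (subst emeasure_distr) auto
  qed simp
  have "distr (uniform_sphere r) borel T = distr ?U borel (T \<circ> (\<lambda>x. r *\<^sub>R sgn x))"
    unfolding uniform_sphere_def by (subst distr_distr) auto
  also have "T \<circ> (\<lambda>x. r *\<^sub>R sgn x) = (\<lambda>x. r *\<^sub>R sgn x) \<circ> T"
    by (auto simp: sgnT)
  also have "distr ?U borel ((\<lambda>x. r *\<^sub>R sgn x) \<circ> T) = distr (distr ?U borel T) borel (\<lambda>x. r *\<^sub>R sgn x)"
    by (subst distr_distr) auto
  finally show ?thesis by (simp add: inv uniform_sphere_def)
qed

end

theory Submission
  imports Defs
begin

text \<open>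
  The proof is an instance of Stein's method. Let \<open>n\<close> be the dimension and
  \<open>W = \<langle>X, \<theta>\<rangle>\<close>. For a test function \<open>g\<close> with Gaussian mean \<open>m\<close>,
  Stein's equation \<open>f' x - x * f x = g x - m\<close> has a solution with
  \<open>\<bar>f'\<bar> \<le> 2 * sup \<bar>g - m\<bar> \<le> 4\<close> (\<open>stein_equation_solution\<close>), so that the error
  \<open>E g(W) - m\<close> equals \<open>E (f'(W) - W * f(W))\<close>. It remains to see how far \<open>W\<close> is from
  satisfying the Gaussian integration by parts formula \<open>E (W * f(W)) = E f'(W)\<close>.

  Rotation invariance of the sphere gives the exact substitute
  \<open>(n - 1) * E (W * f(W)) = E ((n - W\<^sup>2) * f'(W))\<close> (\<open>sphere_stein_identity\<close>), by
  differentiating the constant expectation of a function along the rotations of a plane that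
  contains \<open>\<theta>\<close>. Hence
  \<open>(n - 1) * (E g(W) - m) = E ((W\<^sup>2 - 1) * f'(W))\<close>, which is at most
  \<open>4 * E \<bar>W\<^sup>2 - 1\<bar>\<close> in absolute value. The same identity, applied to \<open>f x = x\<close> and
  \<open>f x = x ^ 3\<close>, gives \<open>E W\<^sup>2 = 1\<close> and \<open>E W ^ 4 = 3 * n / (n + 2)\<close>, so the variance of
  \<open>W\<^sup>2\<close> is \<open>2 * (n - 1) / (n + 2)\<close>, and its square root bounds \<open>E \<bar>W\<^sup>2 - 1\<bar>\<close>.
\<close>

section \<open>Stein's equation for the Gaussian\<close>

lemma DERIV_std_normal_density:
  "(std_normal_density has_real_derivative - x * std_normal_density x) (at x)"
proof -
  define c where "c = 1 / sqrt (2 * pi)"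
  have *: "std_normal_density = (\<lambda>x. c * exp (- x\<^sup>2 / 2))"
    by (simp add: fun_eq_iff std_normal_density_def c_def)
  show ?thesis
    unfolding * by (auto intro!: derivative_eq_intros)
qed

lemma std_normal_density_pos: "std_normal_density x > 0"
  by (simp add: normal_density_pos)

text \<open>
  Because the total integral is zero, the constant that makes an antiderivative vanish at
  \<open>+\<infinity>\<close> also makes it vanish at \<open>-\<infinity>\<close>. Limits along the integers are all that the tail
  bound below consumes.
\<close>

lemma antiderivative_vanishing_at_infinity:
  fixes k :: "real \<Rightarrow> real"
  assumes cont: "\<And>x. isCont k x" and int: "integrable lborel k" and zero: "(\<integral>x. k x \<partial>lborel) = 0"
  obtains H where "\<And>x. (H has_real_derivative k x) (at x)"
    "(\<lambda>n. H (real n)) \<longlonglongrightarrow> 0" "(\<lambda>n. H (- real n)) \<longlonglongrightarrow> 0"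
proof -
  obtain F where F: "\<And>x. (F has_real_derivative k x) (at x)"
    using einterval_antiderivative[of "-\<infinity>" \<infinity> k] cont
    by (auto simp: has_real_derivative_iff_has_vector_derivative)
  have [measurable]: "k \<in> borel_measurable borel"
    using int by (simp add: borel_measurable_integrable)
  have ivl: "(\<lambda>n. \<integral>x. k x * indicator {a n..b n} x \<partial>lborel) \<longlonglongrightarrow> (\<integral>x. k x * indicator S x \<partial>lborel)"
    if [measurable]: "S \<in> sets borel"
      and ev: "\<And>x. eventually (\<lambda>n. x \<in> {a n..b n} \<longleftrightarrow> x \<in> S) sequentially"
    for a b :: "nat \<Rightarrow> real" and S
  proof (rule integral_dominated_convergence[where w = "\<lambda>x. \<bar>k x\<bar>"])
    show "AE x in lborel. (\<lambda>n. k x * indicator {a n..b n} x) \<longlonglongrightarrow> k x * indicator S x"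
    proof (rule AE_I2)
      fix x
      show "(\<lambda>n. k x * indicator {a n..b n} x) \<longlonglongrightarrow> k x * indicator S x"
        by (rule tendsto_eventually, rule eventually_mono[OF ev[of x]]) (auto simp: indicator_def)
    qed
  qed (use int in \<open>auto simp: indicator_def\<close>)
  have large: "eventually (\<lambda>n. x \<le> real n) sequentially" for x
    using filterlim_real_sequentially by (simp add: filterlim_at_top)
  have FTC: "(\<integral>x. k x * indicator {a..b} x \<partial>lborel) = F b - F a" if "a \<le> b" for a b
    using integral_FTC_Icc_real[of a b F k] that F cont by auto
  let ?P = "\<integral>x. k x * indicator {0..} x \<partial>lborel"
  have right: "(\<lambda>n. F (real n) - F 0) \<longlonglongrightarrow> ?P"
  proof -
    have "(\<lambda>n. \<integral>x. k x * indicator {0..real n} x \<partial>lborel) \<longlonglongrightarrow> ?P"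
    proof (rule ivl)
      fix x :: real
      show "eventually (\<lambda>n. x \<in> {0..real n} \<longleftrightarrow> x \<in> {0..}) sequentially"
        using large[of x] by eventually_elim auto
    qed simp
    then show ?thesis by (simp add: FTC)
  qed
  have both: "(\<lambda>n. F (real n) - F (- real n)) \<longlonglongrightarrow> 0"
  proof -
    have "(\<lambda>n. \<integral>x. k x * indicator {- real n..real n} x \<partial>lborel)
             \<longlonglongrightarrow> (\<integral>x. k x * indicator UNIV x \<partial>lborel)"
    proof (rule ivl)
      fix x :: real
      show "eventually (\<lambda>n. x \<in> {- real n..real n} \<longleftrightarrow> x \<in> UNIV) sequentially"
        using large[of "\<bar>x\<bar>"] by eventually_elim auto
    qed simp
    then show ?thesis by (simp add: FTC zero)
  qed
  have "(\<lambda>n. F (real n) - F 0 - ?P) \<longlonglongrightarrow> ?P - ?P"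
    by (rule tendsto_diff[OF right tendsto_const])
  moreover from tendsto_diff[OF this both]
  have "(\<lambda>n. F (- real n) - F 0 - ?P) \<longlonglongrightarrow> ?P - ?P"
    by (simp add: algebra_simps)
  ultimately show thesis
    by (intro that[of "\<lambda>x. F x - F 0 - ?P"]) (auto intro!: derivative_eq_intros F)
qed

text \<open>
  This is the Mills ratio estimate in differential form. Since the density \<open>p\<close> satisfies
  \<open>p' t = - t * p t\<close>, and \<open>x \<le> t\<close> to the right of \<open>x\<close>, the functions
  \<open>\<plusminus> x * H t - C * p t\<close> are nondecreasing there; comparing with \<open>t \<rightarrow> \<infinity>\<close> gives the bound
  at \<open>t = x\<close>.
\<close>

lemma gaussian_tail_bound_pos:
  fixes H k :: "real \<Rightarrow> real"
  assumes H: "\<And>x. (H has_real_derivative k x) (at x)"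
    and k: "\<And>x. \<bar>k x\<bar> \<le> C * std_normal_density x"
    and lim: "(\<lambda>n. H (real n)) \<longlonglongrightarrow> 0" and x: "x > 0"
  shows "\<bar>x * H x\<bar> \<le> C * std_normal_density x"
proof -
  have C: "0 \<le> C"
    using k[of 0] std_normal_density_pos[of 0] by (smt (verit) mult_neg_pos)
  have bd: "s * x * H x - C * std_normal_density x \<le> 0" if s: "\<bar>s\<bar> = 1" for s :: real
  proof (rule LIMSEQ_le_const)
    show "(\<lambda>n. s * x * H (real n)) \<longlonglongrightarrow> 0"
      using tendsto_mult_right_zero[OF lim, of "s * x"] by simp
    have "s * x * H x - C * std_normal_density x \<le> s * x * H (real n)" if n: "x \<le> real n" for n
    proof -
      have "s * x * H x - C * std_normal_density x
              \<le> s * x * H (real n) - C * std_normal_density (real n)"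
      proof (rule DERIV_nonneg_imp_nondecreasing[OF n])
        fix t assume t: "x \<le> t"
        have "((\<lambda>t. s * x * H t - C * std_normal_density t) has_real_derivative
                 s * x * k t + C * (t * std_normal_density t)) (at t)"
          by (auto intro!: derivative_eq_intros H DERIV_std_normal_density simp: algebra_simps)
        moreover have "\<bar>s * x * k t\<bar> \<le> t * (C * std_normal_density t)"
          using k[of t] t x s by (simp add: abs_mult mult_mono)
        then have "0 \<le> s * x * k t + C * (t * std_normal_density t)"
          by (simp add: abs_le_iff algebra_simps)
        ultimately show "\<exists>y. ((\<lambda>t. s * x * H t - C * std_normal_density t)
            has_real_derivative y) (at t) \<and> 0 \<le> y"
          by blast
      qed
      moreover have "0 \<le> C * std_normal_density (real n)"
        using C by simp
      ultimately show ?thesis by linarith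
    qed
    moreover obtain N where "x \<le> real N"
      using real_arch_simple by blast
    ultimately show "\<exists>N. \<forall>n\<ge>N. s * x * H x - C * std_normal_density x \<le> s * x * H (real n)"
      by (meson of_nat_mono order_trans)
  qed
  show ?thesis
    using bd[of 1] bd[of "-1"] by (simp add: abs_le_iff)
qed

lemma gaussian_tail_bound:
  fixes H k :: "real \<Rightarrow> real"
  assumes H: "\<And>x. (H has_real_derivative k x) (at x)"
    and k: "\<And>x. \<bar>k x\<bar> \<le> C * std_normal_density x"
    and lim: "(\<lambda>n. H (real n)) \<longlonglongrightarrow> 0" "(\<lambda>n. H (- real n)) \<longlonglongrightarrow> 0"
  shows "\<bar>x * H x\<bar> \<le> C * std_normal_density x"
proof (cases x "0 :: real" rule: linorder_cases)
  case less
  have sym: "std_normal_density (- y) = std_normal_density y" for y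
    by (simp add: std_normal_density_def)
  have "\<bar>- x * H (- (- x))\<bar> \<le> C * std_normal_density (- x)"
  proof (rule gaussian_tail_bound_pos[where H = "\<lambda>y. H (- y)" and k = "\<lambda>y. - k (- y)"])
    fix y
    show "((\<lambda>y. H (- y)) has_real_derivative - k (- y)) (at y)"
      using DERIV_mirror[of H "k (- y)" y] H[of "- y"] by simp
    show "\<bar>- k (- y)\<bar> \<le> C * std_normal_density y"
      using k[of "- y"] by (simp add: sym)
  qed (use lim less in auto)
  then show ?thesis
    by (simp add: sym)
next
  case equal
  then show ?thesis
    using k[of 0] by simp
next
  case greater
  then show ?thesis
    by (rule gaussian_tail_bound_pos[OF H k lim(1)])
qed

text \<open>
  Dividing by the density turns Stein's equation into \<open>(p * f)' = p * h\<close>. Of its solutions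
  the one needed is that for which \<open>p * f\<close> vanishes at both ends, which exists because \<open>h\<close>
  has Gaussian mean zero. The tail bound then says \<open>\<bar>x * f x\<bar> \<le> C\<close>, and the equation itself
  bounds the derivative.
\<close>

lemma stein_equation_solution:
  fixes h :: "real \<Rightarrow> real"
  assumes cont: "continuous_on UNIV h" and bound: "\<And>x. \<bar>h x\<bar> \<le> C"
    and mean: "(\<integral>x. std_normal_density x * h x \<partial>lborel) = 0"
  obtains f f' where "\<And>x. (f has_real_derivative f' x) (at x)" "continuous_on UNIV f'"
    "\<And>x. f' x - x * f x = h x" "\<And>x. \<bar>f' x\<bar> \<le> 2 * C"
proof -
  let ?p = std_normal_density
  have hm [measurable]: "h \<in> borel_measurable borel"
    using cont by (rule borel_measurable_continuous_onI)
  have le: "\<bar>?p x * h x\<bar> \<le> C * ?p x" for x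
    using bound[of x] by (simp add: abs_mult mult.commute mult_right_mono)
  have "integrable lborel (\<lambda>x. C * ?p x)"
    using integrable_std_normal_moment[of 0] by simp
  then have int: "integrable lborel (\<lambda>x. ?p x * h x)"
    by (rule Bochner_Integration.integrable_bound) (use le in \<open>auto intro: order_trans[OF _ abs_ge_self]\<close>)
  have cont': "isCont (\<lambda>x. ?p x * h x) x" for x
    using cont by (intro continuous_intros DERIV_isCont[OF DERIV_std_normal_density])
      (auto simp: continuous_on_eq_continuous_at)
  obtain H where H: "\<And>x. (H has_real_derivative ?p x * h x) (at x)"
    and lim: "(\<lambda>n. H (real n)) \<longlonglongrightarrow> 0" "(\<lambda>n. H (- real n)) \<longlonglongrightarrow> 0"
    using antiderivative_vanishing_at_infinity[OF cont' int mean] by blast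
  define f where "f x = H x / ?p x" for x
  have df: "(f has_real_derivative h x + x * f x) (at x)" for x
  proof -
    have p: "?p x \<noteq> 0"
      using std_normal_density_pos[of x] by simp
    show ?thesis
      unfolding f_def
      by (rule DERIV_cong[OF DERIV_divide[OF H DERIV_std_normal_density p]])
        (use p in \<open>simp add: field_simps power2_eq_square\<close>)
  qed
  have "\<bar>x * f x\<bar> \<le> C" for x
    using gaussian_tail_bound[OF H le lim, of x] std_normal_density_pos[of x]
    by (simp add: f_def abs_mult field_simps)
  then have "\<bar>h x + x * f x\<bar> \<le> 2 * C" for x
    using bound[of x] by (smt (verit))
  moreover have "continuous_on UNIV f"
    using df DERIV_isCont by (auto simp: continuous_on_eq_continuous_at)
  then have "continuous_on UNIV (\<lambda>x. h x + x * f x)"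
    using cont by (intro continuous_intros)
  ultimately show thesis
    using df by (intro that[of f "\<lambda>x. h x + x * f x"]) auto
qed

section \<open>Integration by parts on the sphere\<close>

lemma bounded_on_sphere:
  fixes \<phi> :: "'a::euclidean_space \<Rightarrow> real"
  assumes "continuous_on UNIV \<phi>"
  obtains B where "\<And>x. x \<in> sphere 0 r \<Longrightarrow> \<bar>\<phi> x\<bar> \<le> B"
proof -
  have "compact (\<phi> ` sphere 0 r)"
    using assms by (intro compact_continuous_image) (auto intro: continuous_on_subset)
  then obtain B where "\<And>y. y \<in> \<phi> ` sphere 0 r \<Longrightarrow> norm y \<le> B"
    using compact_imp_bounded bounded_iff by metis
  then show thesis
    by (intro that[of B]) auto
qed

lemma integrable_uniform_sphere:
  fixes \<phi> :: "'a::euclidean_space \<Rightarrow> real"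
  assumes cont: "continuous_on UNIV \<phi>" and r: "r \<ge> 0"
  shows "integrable (uniform_sphere r) \<phi>"
proof -
  interpret prob_space "uniform_sphere r :: 'a measure"
    by (rule prob_space_uniform_sphere)
  obtain B where B: "\<And>x. x \<in> sphere 0 r \<Longrightarrow> \<bar>\<phi> x\<bar> \<le> B"
    using bounded_on_sphere[OF cont] by blast
  have "AE x in uniform_sphere r. norm (\<phi> x) \<le> B"
    using AE_uniform_sphere[OF r] by (rule eventually_mono) (use B in simp)
  moreover have "\<phi> \<in> borel_measurable (uniform_sphere r)"
    using borel_measurable_continuous_onI[OF cont] by (simp cong: measurable_cong_sets)
  ultimately show ?thesis
    by (rule integrable_const_bound)
qed

text \<open>
  For orthonormal \<open>u\<close> and \<open>v\<close> this is the rotation by the angle \<open>t\<close> from \<open>u\<close> towards \<open>v\<close>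
  that fixes the orthogonal complement of their span.
\<close>

definition plane_rotation :: "'a::euclidean_space \<Rightarrow> 'a \<Rightarrow> real \<Rightarrow> 'a \<Rightarrow> 'a" where
  "plane_rotation u v t x =
     x + ((cos t - 1) * (x \<bullet> u) - sin t * (x \<bullet> v)) *\<^sub>R u
       + (sin t * (x \<bullet> u) + (cos t - 1) * (x \<bullet> v)) *\<^sub>R v"

context
  fixes u v :: "'a::euclidean_space"
  assumes uv: "norm u = 1" "norm v = 1" "u \<bullet> v = 0"
begin

lemma plane_rotation_inner:
  "plane_rotation u v t x \<bullet> u = cos t * (x \<bullet> u) - sin t * (x \<bullet> v)"
  "plane_rotation u v t x \<bullet> v = sin t * (x \<bullet> u) + cos t * (x \<bullet> v)"
proof -
  have "u \<bullet> u = 1" "v \<bullet> v = 1" "v \<bullet> u = 0"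
    using uv by (auto simp: norm_eq_1 inner_commute)
  then show "plane_rotation u v t x \<bullet> u = cos t * (x \<bullet> u) - sin t * (x \<bullet> v)"
    "plane_rotation u v t x \<bullet> v = sin t * (x \<bullet> u) + cos t * (x \<bullet> v)"
    using uv(3) by (simp_all add: plane_rotation_def inner_add_left algebra_simps)
qed

lemma orthogonal_transformation_plane_rotation:
  "orthogonal_transformation (plane_rotation u v t)"
proof -
  have "linear (plane_rotation u v t)"
    by (rule linearI) (simp_all add: plane_rotation_def inner_add_left algebra_simps)
  moreover have "plane_rotation u v t x \<bullet> plane_rotation u v t y = x \<bullet> y" for x y
  proof -
    have *: "x \<bullet> plane_rotation u v t y =
        x \<bullet> y + ((cos t - 1) * (y \<bullet> u) - sin t * (y \<bullet> v)) * (x \<bullet> u)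
          + (sin t * (y \<bullet> u) + (cos t - 1) * (y \<bullet> v)) * (x \<bullet> v)"
      by (simp add: plane_rotation_def inner_add_right)
    have "plane_rotation u v t x \<bullet> plane_rotation u v t y =
        x \<bullet> plane_rotation u v t y
          + ((cos t - 1) * (x \<bullet> u) - sin t * (x \<bullet> v)) * (plane_rotation u v t y \<bullet> u)
          + (sin t * (x \<bullet> u) + (cos t - 1) * (x \<bullet> v)) * (plane_rotation u v t y \<bullet> v)"
      unfolding plane_rotation_def[of u v t x]
      by (simp add: inner_add_left inner_add_right inner_commute[of _ "plane_rotation u v t y"])
    also have "\<dots> = x \<bullet> y"
      unfolding * plane_rotation_inner
      using sin_cos_squared_add[of t] by algebra
    finally show ?thesis .
  qed
  ultimately show ?thesis
    by (simp add: orthogonal_transformation_def)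
qed

text \<open>
  By rotation invariance the expectation of \<open>F (R\<^sub>t x)\<close>, where
  \<open>F y = (y \<bullet> v) * f (y \<bullet> u)\<close>, does not depend on \<open>t\<close>. Its derivative at \<open>t = 0\<close> is the
  expectation of \<open>G\<close> with \<open>G y = (y \<bullet> u) * f (y \<bullet> u) - (y \<bullet> v)\<^sup>2 * f' (y \<bullet> u)\<close>,
  which is therefore zero. Dominated convergence justifies differentiating under the integral:
  \<open>G\<close> is bounded on the sphere and the derivative at any \<open>t\<close> is \<open>G (R\<^sub>t x)\<close>.
\<close>

lemma sphere_integration_by_parts:
  assumes f: "\<And>x. (f has_real_derivative f' x) (at x)" and f': "continuous_on UNIV f'"
    and r: "r \<ge> 0"
  shows "(\<integral>x. (x \<bullet> u) * f (x \<bullet> u) \<partial>uniform_sphere r) = (\<integral>x. (x \<bullet> v)\<^sup>2 * f' (x \<bullet> u) \<partial>uniform_sphere r)"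
proof -
  let ?\<mu> = "uniform_sphere r :: 'a measure"
  let ?R = "plane_rotation u v"
  let ?F = "\<lambda>y. (y \<bullet> v) * f (y \<bullet> u)"
  let ?G = "\<lambda>y. (y \<bullet> u) * f (y \<bullet> u) - (y \<bullet> v)\<^sup>2 * f' (y \<bullet> u)"
  define t where "t k = 1 / (real k + 1)" for k
  interpret prob_space ?\<mu>
    by (rule prob_space_uniform_sphere)
  have cf: "continuous_on UNIV f"
    using f DERIV_isCont by (auto simp: continuous_on_eq_continuous_at)
  have cc: "continuous_on UNIV (\<lambda>x :: 'a. f (x \<bullet> u))" "continuous_on UNIV (\<lambda>x :: 'a. f' (x \<bullet> u))"
    by (auto intro!: continuous_intros continuous_on_compose2[OF cf] continuous_on_compose2[OF f'])
  have cF: "continuous_on UNIV ?F" and cG: "continuous_on UNIV ?G"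
    by (auto intro!: continuous_intros cc)
  have Rm [measurable]: "?R s \<in> borel_measurable borel" for s
    by (intro measurable_orthogonal_transformation orthogonal_transformation_plane_rotation)
  have [measurable]: "?F \<in> borel_measurable borel" "?G \<in> borel_measurable borel"
    using cF cG by (auto intro: borel_measurable_continuous_onI)
  have deriv: "((\<lambda>s. ?F (?R s x)) has_real_derivative ?G (?R s x)) (at s)" for s x
    unfolding plane_rotation_inner
    by (auto intro!: derivative_eq_intros DERIV_chain2[OF f] simp: algebra_simps power2_eq_square)
  have R0: "?R 0 x = x" for x
    by (simp add: plane_rotation_def)
  have intF: "integrable ?\<mu> ?F"
    using cF r by (rule integrable_uniform_sphere)
  have inv: "integrable ?\<mu> (\<lambda>x. ?F (?R s x))"
    "(\<integral>x. ?F (?R s x) \<partial>?\<mu>) = (\<integral>x. ?F x \<partial>?\<mu>)" for s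
  proof -
    have D: "distr ?\<mu> borel (?R s) = ?\<mu>"
      by (intro uniform_sphere_rotation_invariant orthogonal_transformation_plane_rotation)
    have "integrable (distr ?\<mu> borel (?R s)) ?F"
      using intF by (simp add: D)
    then show "integrable ?\<mu> (\<lambda>x. ?F (?R s x))"
      by (subst (asm) integrable_distr_eq) auto
    have "(\<integral>x. ?F x \<partial>?\<mu>) = (\<integral>x. ?F x \<partial>distr ?\<mu> borel (?R s))"
      by (simp add: D)
    also have "\<dots> = (\<integral>x. ?F (?R s x) \<partial>?\<mu>)"
      by (rule integral_distr) auto
    finally show "(\<integral>x. ?F (?R s x) \<partial>?\<mu>) = (\<integral>x. ?F x \<partial>?\<mu>)" ..
  qed
  obtain B where B: "\<And>x. x \<in> sphere 0 r \<Longrightarrow> \<bar>?G x\<bar> \<le> B"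
    using bounded_on_sphere[OF cG] by blast
  have t: "t k > 0" for k
    by (simp add: t_def)
  have t0: "filterlim t (at 0) sequentially"
  proof -
    have "t \<longlonglongrightarrow> 0"
      using LIMSEQ_inverse_real_of_nat by (simp add: t_def[abs_def] inverse_eq_divide add.commute)
    then show ?thesis
      using t by (auto simp: filterlim_at less_le)
  qed
  have "(\<lambda>k. \<integral>x. (?F (?R (t k) x) - ?F x) / t k \<partial>?\<mu>) \<longlonglongrightarrow> (\<integral>x. ?G x \<partial>?\<mu>)"
  proof (rule integral_dominated_convergence[where w = "\<lambda>_. B"])
    show "AE x in ?\<mu>. (\<lambda>k. (?F (?R (t k) x) - ?F x) / t k) \<longlonglongrightarrow> ?G x"
    proof (rule AE_I2)
      fix x
      have "((\<lambda>s. (?F (?R s x) - ?F x) / s) \<longlongrightarrow> ?G x) (at 0)"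
        using deriv[of x 0] by (simp add: DERIV_def R0)
      then show "(\<lambda>k. (?F (?R (t k) x) - ?F x) / t k) \<longlonglongrightarrow> ?G x"
        using t0 by (rule filterlim_compose)
    qed
    show "AE x in ?\<mu>. norm ((?F (?R (t k) x) - ?F x) / t k) \<le> B" for k
      using AE_uniform_sphere[OF r]
    proof (rule eventually_mono)
      fix x :: 'a assume "x \<in> sphere 0 r"
      then have "?R s x \<in> sphere 0 r" for s
        by (simp add: orthogonal_transformation_norm[OF orthogonal_transformation_plane_rotation])
      then have "norm (?F (?R (t k) x) - ?F (?R 0 x)) \<le> B * norm (t k - 0)"
        using B deriv
        by (intro field_differentiable_bound[of UNIV _ "\<lambda>s. ?G (?R s x)"]) auto
      then show "norm ((?F (?R (t k) x) - ?F x) / t k) \<le> B"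
        using t[of k] by (simp add: R0 field_simps)
    qed
  qed auto
  moreover have "(\<integral>x. (?F (?R (t k) x) - ?F x) / t k \<partial>?\<mu>) = 0" for k
    using inv intF by simp
  ultimately have "(\<integral>x. ?G x \<partial>?\<mu>) = 0"
    by (simp only: LIMSEQ_const_iff)
  moreover have "integrable ?\<mu> (\<lambda>x. (x \<bullet> u) * f (x \<bullet> u))" "integrable ?\<mu> (\<lambda>x. (x \<bullet> v)\<^sup>2 * f' (x \<bullet> u))"
    using r by (intro integrable_uniform_sphere; auto intro!: continuous_intros cc)+
  ultimately show ?thesis by simp
qed

end

text \<open>
  The idea is to sum the preceding formula over an orthonormal basis of the complement of \<open>u\<close>.
  To avoid a choice of basis, the sum runs over the projections \<open>w b\<close> of the standard basis
  vectors to that complement. They form a tight frame, for which the two sums that occur,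
  \<open>\<Sum>\<bar>w b\<bar>\<^sup>2\<close> and \<open>\<Sum>(x \<bullet> w b)\<^sup>2\<close>, have the same values as for an orthonormal basis.
\<close>

lemma sphere_stein_identity:
  fixes u :: "'a::euclidean_space"
  assumes u: "norm u = 1" and f: "\<And>x. (f has_real_derivative f' x) (at x)"
    and f': "continuous_on UNIV f'" and r: "r \<ge> 0"
  shows "(real DIM('a) - 1) * (\<integral>x. (x \<bullet> u) * f (x \<bullet> u) \<partial>uniform_sphere r)
       = (\<integral>x. (r\<^sup>2 - (x \<bullet> u)\<^sup>2) * f' (x \<bullet> u) \<partial>uniform_sphere r)"
proof -
  let ?\<mu> = "uniform_sphere r :: 'a measure"
  let ?I = "\<integral>x. (x \<bullet> u) * f (x \<bullet> u) \<partial>?\<mu>"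
  define w where "w b = b - (b \<bullet> u) *\<^sub>R u" for b
  have uu: "u \<bullet> u = 1"
    using u by (simp add: norm_eq_1)
  have cc: "continuous_on UNIV (\<lambda>x :: 'a. f' (x \<bullet> u))"
    by (auto intro!: continuous_intros continuous_on_compose2[OF f'])
  have int: "integrable ?\<mu> (\<lambda>x. (x \<bullet> v)\<^sup>2 * f' (x \<bullet> u))" for v
    using r by (intro integrable_uniform_sphere) (auto intro!: continuous_intros cc)
  have scaled: "(norm v)\<^sup>2 * ?I = (\<integral>x. (x \<bullet> v)\<^sup>2 * f' (x \<bullet> u) \<partial>?\<mu>)" if v: "u \<bullet> v = 0" for v
  proof (cases "v = 0")
    case False
    have "?I = (\<integral>x. (x \<bullet> (v /\<^sub>R norm v))\<^sup>2 * f' (x \<bullet> u) \<partial>?\<mu>)"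
      using False v by (intro sphere_integration_by_parts u f f' r) auto
    also have "(\<lambda>x. (x \<bullet> (v /\<^sub>R norm v))\<^sup>2 * f' (x \<bullet> u)) =
        (\<lambda>x. ((x \<bullet> v)\<^sup>2 * f' (x \<bullet> u)) / (norm v)\<^sup>2)"
      by (auto simp: divide_simps)
    finally show ?thesis
      using False by simp
  qed simp
  have sums: "(\<Sum>b\<in>Basis. (x \<bullet> w b)\<^sup>2) = x \<bullet> x - (x \<bullet> u)\<^sup>2" for x :: 'a
  proof -
    have "(x \<bullet> w b)\<^sup>2 = (x \<bullet> b) * (x \<bullet> b) - 2 * (x \<bullet> u) * ((x \<bullet> b) * (u \<bullet> b))
            + (x \<bullet> u)\<^sup>2 * ((u \<bullet> b) * (u \<bullet> b))" for b
      by (simp add: w_def inner_diff_right power2_eq_square inner_commute algebra_simps)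
    then have "(\<Sum>b\<in>Basis. (x \<bullet> w b)\<^sup>2) =
        x \<bullet> x - 2 * (x \<bullet> u) * (x \<bullet> u) + (x \<bullet> u)\<^sup>2 * (u \<bullet> u)"
      by (simp add: sum.distrib sum_subtractf sum_distrib_left[symmetric] euclidean_inner[symmetric])
    then show ?thesis
      by (simp add: uu power2_eq_square)
  qed
  have "(\<Sum>b\<in>Basis. (norm (w b))\<^sup>2) = real DIM('a) - 1"
  proof -
    have "(norm (w b))\<^sup>2 = 1 - (u \<bullet> b) * (u \<bullet> b)" if "b \<in> Basis" for b
      using that uu unfolding w_def power2_norm_eq_inner
      by (simp add: inner_diff_left inner_diff_right inner_commute algebra_simps)
    then show ?thesis
      using uu by (simp add: sum_subtractf euclidean_inner[symmetric])
  qed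
  then have "(real DIM('a) - 1) * ?I = (\<Sum>b\<in>Basis. (norm (w b))\<^sup>2 * ?I)"
    by (simp only: sum_distrib_right[symmetric])
  also have "\<dots> = (\<Sum>b\<in>Basis. \<integral>x. (x \<bullet> w b)\<^sup>2 * f' (x \<bullet> u) \<partial>?\<mu>)"
    by (intro sum.cong scaled) (auto simp: w_def inner_diff_right uu inner_commute)
  also have "\<dots> = (\<integral>x. (\<Sum>b\<in>Basis. (x \<bullet> w b)\<^sup>2 * f' (x \<bullet> u)) \<partial>?\<mu>)"
    by (rule Bochner_Integration.integral_sum[symmetric]) (rule int)
  also have "\<dots> = (\<integral>x. (x \<bullet> x - (x \<bullet> u)\<^sup>2) * f' (x \<bullet> u) \<partial>?\<mu>)"
    by (simp add: sum_distrib_right[symmetric] sums)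
  also have "\<dots> = (\<integral>x. (r\<^sup>2 - (x \<bullet> u)\<^sup>2) * f' (x \<bullet> u) \<partial>?\<mu>)"
  proof (rule integral_cong_AE)
    show "AE x in ?\<mu>. (x \<bullet> x - (x \<bullet> u)\<^sup>2) * f' (x \<bullet> u) = (r\<^sup>2 - (x \<bullet> u)\<^sup>2) * f' (x \<bullet> u)"
      using AE_uniform_sphere[OF r]
      by (rule eventually_mono) (auto simp: power2_norm_eq_inner[symmetric])
  qed (auto intro!: borel_measurable_integrable integrable_uniform_sphere continuous_intros cc r)
  finally show ?thesis .
qed

section \<open>Moments of a coordinate\<close>

context
  fixes u :: "'a::euclidean_space" and n :: real
  assumes u: "norm u = 1" and n_def: "n = real DIM('a)"
begin

lemma sphere_coordinate_moments:
  "(\<integral>x. (x \<bullet> u)\<^sup>2 \<partial>uniform_sphere (sqrt n)) = 1"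
  "(\<integral>x. (x \<bullet> u) ^ 4 \<partial>uniform_sphere (sqrt n)) = 3 * n / (n + 2)"
proof -
  let ?\<mu> = "uniform_sphere (sqrt n) :: 'a measure"
  have n: "n \<ge> 1"
    using DIM_positive[where 'a = 'a] by (simp add: n_def)
  interpret prob_space ?\<mu>
    by (rule prob_space_uniform_sphere)
  have int: "integrable ?\<mu> (\<lambda>x. (x \<bullet> u) ^ k)" for k
    using n by (intro integrable_uniform_sphere continuous_intros) auto
  have "(n - 1) * (\<integral>x. (x \<bullet> u) * (x \<bullet> u) \<partial>?\<mu>) = (\<integral>x. ((sqrt n)\<^sup>2 - (x \<bullet> u)\<^sup>2) * 1 \<partial>?\<mu>)"
    unfolding n_def
    by (rule sphere_stein_identity[OF u]) auto
  also have "\<dots> = n - (\<integral>x. (x \<bullet> u)\<^sup>2 \<partial>?\<mu>)"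
    using n int[of 2] by (simp add: prob_space)
  finally have "n * (\<integral>x. (x \<bullet> u)\<^sup>2 \<partial>?\<mu>) = n"
    by (simp add: power2_eq_square[symmetric] algebra_simps)
  then show m2: "(\<integral>x. (x \<bullet> u)\<^sup>2 \<partial>?\<mu>) = 1"
    using n by simp
  have "(n - 1) * (\<integral>x. (x \<bullet> u) * (x \<bullet> u) ^ 3 \<partial>?\<mu>) =
      (\<integral>x. ((sqrt n)\<^sup>2 - (x \<bullet> u)\<^sup>2) * (3 * (x \<bullet> u)\<^sup>2) \<partial>?\<mu>)"
    unfolding n_def
    by (rule sphere_stein_identity[OF u]) (auto intro!: derivative_eq_intros continuous_intros)
  also have "\<dots> = (\<integral>x. 3 * n * (x \<bullet> u)\<^sup>2 - 3 * (x \<bullet> u) ^ 4 \<partial>?\<mu>)"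
    using n by (intro Bochner_Integration.integral_cong) (auto simp: algebra_simps power_numeral_reduce)
  also have "\<dots> = 3 * n - 3 * (\<integral>x. (x \<bullet> u) ^ 4 \<partial>?\<mu>)"
    using int[of 2] int[of 4] by (simp add: m2)
  finally have "(n + 2) * (\<integral>x. (x \<bullet> u) ^ 4 \<partial>?\<mu>) = 3 * n"
    by (simp add: power_numeral_reduce algebra_simps)
  then show "(\<integral>x. (x \<bullet> u) ^ 4 \<partial>?\<mu>) = 3 * n / (n + 2)"
    using n by (simp add: field_simps)
qed

text \<open>
  This is the Cauchy-Schwarz inequality \<open>E \<bar>Y\<bar> \<le> sqrt (E Y\<^sup>2)\<close> for \<open>Y = W\<^sup>2 - 1\<close>, in the
  form \<open>2 * \<bar>Y\<bar> \<le> Y\<^sup>2 / \<sigma> + \<sigma>\<close> with \<open>\<sigma>\<^sup>2 = E Y\<^sup>2\<close>.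
\<close>

lemma sphere_coordinate_square_deviation:
  assumes n2: "n \<ge> 2"
  shows "(\<integral>x. \<bar>(x \<bullet> u)\<^sup>2 - 1\<bar> \<partial>uniform_sphere (sqrt n)) \<le> sqrt (2 * (n - 1) / (n + 2))"
proof -
  let ?\<mu> = "uniform_sphere (sqrt n) :: 'a measure"
  define \<sigma> where "\<sigma> = sqrt (2 * (n - 1) / (n + 2))"
  have \<sigma>: "\<sigma> > 0" "\<sigma>\<^sup>2 = 2 * (n - 1) / (n + 2)"
    using n2 by (auto simp: \<sigma>_def)
  interpret prob_space ?\<mu>
    by (rule prob_space_uniform_sphere)
  have int: "integrable ?\<mu> (\<lambda>x. (x \<bullet> u) ^ k)" for k
    using n2 by (intro integrable_uniform_sphere continuous_intros) auto
  have sq: "((x \<bullet> u)\<^sup>2 - 1)\<^sup>2 = (x \<bullet> u) ^ 4 - 2 * (x \<bullet> u)\<^sup>2 + 1" for x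
    by (simp add: algebra_simps power_numeral_reduce)
  have var: "(\<integral>x. ((x \<bullet> u)\<^sup>2 - 1)\<^sup>2 \<partial>?\<mu>) = \<sigma>\<^sup>2"
    unfolding sq using int[of 2] int[of 4] n2
    by (simp add: sphere_coordinate_moments prob_space \<sigma>(2) field_simps)
  have amgm: "\<bar>y\<bar> \<le> (y\<^sup>2 / \<sigma> + \<sigma>) / 2" for y
  proof -
    have "0 \<le> (\<bar>y\<bar> - \<sigma>)\<^sup>2" by simp
    then show ?thesis
      using \<sigma>(1) by (simp add: field_simps power2_eq_square)
  qed
  have "(\<integral>x. \<bar>(x \<bullet> u)\<^sup>2 - 1\<bar> \<partial>?\<mu>) \<le> (\<integral>x. (((x \<bullet> u)\<^sup>2 - 1)\<^sup>2 / \<sigma> + \<sigma>) / 2 \<partial>?\<mu>)"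
    using n2 \<sigma>(1)
    by (intro integral_mono amgm integrable_uniform_sphere) (auto intro!: continuous_intros)
  also have "\<dots> = ((\<integral>x. ((x \<bullet> u)\<^sup>2 - 1)\<^sup>2 \<partial>?\<mu>) / \<sigma> + \<sigma>) / 2"
  proof -
    have "integrable ?\<mu> (\<lambda>x. ((x \<bullet> u)\<^sup>2 - 1)\<^sup>2)"
      using n2 by (intro integrable_uniform_sphere continuous_intros) auto
    then show ?thesis by (simp add: prob_space)
  qed
  also have "\<dots> = \<sigma>"
    using \<sigma>(1) unfolding var by (simp add: power2_eq_square)
  finally show ?thesis
    by (simp add: \<sigma>_def)
qed

section \<open>Comparison of a coordinate with the Gaussian\<close>

lemma sphere_coordinate_gaussian_comparison:
  fixes g :: "real \<Rightarrow> real"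
  assumes n2: "n \<ge> 2" and g: "continuous_on UNIV g" and g1: "\<And>x. \<bar>g x\<bar> \<le> 1"
  shows "\<bar>(\<integral>x. g (x \<bullet> u) \<partial>uniform_sphere (sqrt n)) - (\<integral>x. std_normal_density x * g x \<partial>lborel)\<bar>
           \<le> 4 * sqrt 2 / sqrt ((n - 1) * (n + 2))"
proof -
  let ?\<mu> = "uniform_sphere (sqrt n) :: 'a measure"
  let ?p = std_normal_density
  define m where "m = (\<integral>x. ?p x * g x \<partial>lborel)"
  interpret prob_space ?\<mu>
    by (rule prob_space_uniform_sphere)
  have [measurable]: "g \<in> borel_measurable borel"
    using g by (rule borel_measurable_continuous_onI)
  have p: "integrable lborel ?p" "(\<integral>x. ?p x \<partial>lborel) = 1"
    using integrable_std_normal_moment[of 0] integral_std_normal_moment_even[of 0] by simp_all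
  have le: "\<bar>?p x * g x\<bar> \<le> ?p x" for x
    using g1[of x] mult_left_mono[OF g1[of x], of "?p x"] by (simp add: abs_mult)
  have pg: "integrable lborel (\<lambda>x. ?p x * g x)"
    by (rule Bochner_Integration.integrable_bound[OF p(1)]) (use le in auto)
  have "\<bar>m\<bar> \<le> (\<integral>x. \<bar>?p x * g x\<bar> \<partial>lborel)"
    unfolding m_def by (rule integral_abs_bound)
  also have "\<dots> \<le> (\<integral>x. ?p x \<partial>lborel)"
    using le p pg by (intro integral_mono) auto
  finally have m: "\<bar>m\<bar> \<le> 1"
    by (simp add: p)
  have "(\<integral>x. ?p x * (g x - m) \<partial>lborel) = 0"
    using p pg by (simp add: right_diff_distrib m_def)
  moreover have "\<bar>g x - m\<bar> \<le> 2" for x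
    using g1[of x] m by linarith
  moreover have "continuous_on UNIV (\<lambda>x. g x - m)"
    using g by (intro continuous_intros)
  ultimately obtain f f' where f: "\<And>x. (f has_real_derivative f' x) (at x)"
    and f': "continuous_on UNIV f'" and stein: "\<And>x. f' x - x * f x = g x - m"
    and bound: "\<And>x. \<bar>f' x\<bar> \<le> 2 * 2"
    using stein_equation_solution[of "\<lambda>x. g x - m" 2] by blast
  have cf: "continuous_on UNIV f"
    using f DERIV_isCont by (auto simp: continuous_on_eq_continuous_at)
  have cc: "continuous_on UNIV (\<lambda>x :: 'a. f (x \<bullet> u))" "continuous_on UNIV (\<lambda>x :: 'a. f' (x \<bullet> u))"
    "continuous_on UNIV (\<lambda>x :: 'a. g (x \<bullet> u))"
    by (auto intro!: continuous_intros continuous_on_compose2[OF cf] continuous_on_compose2[OF f']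
        continuous_on_compose2[OF g])
  have int: "integrable ?\<mu> \<phi>" if "continuous_on UNIV \<phi>" for \<phi> :: "'a \<Rightarrow> real"
    using that n2 by (intro integrable_uniform_sphere) auto
  have "(\<integral>x. g (x \<bullet> u) \<partial>?\<mu>) - m = (\<integral>x. g (x \<bullet> u) - m \<partial>?\<mu>)"
    using int[OF cc(3)] by (simp add: prob_space)
  also have "\<dots> = (\<integral>x. f' (x \<bullet> u) - (x \<bullet> u) * f (x \<bullet> u) \<partial>?\<mu>)"
    by (simp add: stein)
  also have "\<dots> = (\<integral>x. f' (x \<bullet> u) \<partial>?\<mu>) - (\<integral>x. (x \<bullet> u) * f (x \<bullet> u) \<partial>?\<mu>)"
    by (intro Bochner_Integration.integral_diff int cc continuous_intros)
  finally have "(n - 1) * ((\<integral>x. g (x \<bullet> u) \<partial>?\<mu>) - m) =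
      (n - 1) * (\<integral>x. f' (x \<bullet> u) \<partial>?\<mu>) - (n - 1) * (\<integral>x. (x \<bullet> u) * f (x \<bullet> u) \<partial>?\<mu>)"
    by (simp add: right_diff_distrib)
  also have "(n - 1) * (\<integral>x. (x \<bullet> u) * f (x \<bullet> u) \<partial>?\<mu>) = (\<integral>x. (n - (x \<bullet> u)\<^sup>2) * f' (x \<bullet> u) \<partial>?\<mu>)"
    using sphere_stein_identity[OF u f f', of "sqrt n"] n2 by (simp add: n_def)
  also have "(n - 1) * (\<integral>x. f' (x \<bullet> u) \<partial>?\<mu>) - \<dots> =
      (\<integral>x. (n - 1) * f' (x \<bullet> u) - (n - (x \<bullet> u)\<^sup>2) * f' (x \<bullet> u) \<partial>?\<mu>)"
    by (subst Bochner_Integration.integral_diff) (auto intro!: int cc continuous_intros)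
  also have "\<dots> = (\<integral>x. ((x \<bullet> u)\<^sup>2 - 1) * f' (x \<bullet> u) \<partial>?\<mu>)"
    by (simp add: algebra_simps)
  finally have "\<bar>(n - 1) * ((\<integral>x. g (x \<bullet> u) \<partial>?\<mu>) - m)\<bar> \<le> (\<integral>x. \<bar>((x \<bullet> u)\<^sup>2 - 1) * f' (x \<bullet> u)\<bar> \<partial>?\<mu>)"
    using integral_abs_bound by metis
  also have "\<dots> \<le> (\<integral>x. 4 * \<bar>(x \<bullet> u)\<^sup>2 - 1\<bar> \<partial>?\<mu>)"
  proof (rule integral_mono)
    show "\<bar>((x \<bullet> u)\<^sup>2 - 1) * f' (x \<bullet> u)\<bar> \<le> 4 * \<bar>(x \<bullet> u)\<^sup>2 - 1\<bar>" for x
      using mult_left_mono[OF bound[of "x \<bullet> u"], of "\<bar>(x \<bullet> u)\<^sup>2 - 1\<bar>"] by (simp add: abs_mult)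
  qed (auto intro!: int cc continuous_intros)
  also have "\<dots> \<le> 4 * sqrt (2 * (n - 1) / (n + 2))"
    using sphere_coordinate_square_deviation[OF n2] by simp
  finally have "\<bar>(\<integral>x. g (x \<bullet> u) \<partial>?\<mu>) - m\<bar> \<le> 4 * sqrt (2 * (n - 1) / (n + 2)) / (n - 1)"
    using n2 by (simp add: abs_mult pos_le_divide_eq mult.commute)
  also have "\<dots> = 4 * sqrt 2 / sqrt ((n - 1) * (n + 2))"
  proof -
    have cancel: "4 * (s * q / p) / (q * q) = 4 * s / (q * p)" if "q > 0" for s q p :: real
      using that by (simp add: field_simps)
    have q: "sqrt (n - 1) > 0" "n - 1 = sqrt (n - 1) * sqrt (n - 1)"
      using n2 by auto
    have "4 * sqrt (2 * (n - 1) / (n + 2)) / (n - 1) =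
        4 * (sqrt 2 * sqrt (n - 1) / sqrt (n + 2)) / (sqrt (n - 1) * sqrt (n - 1))"
      unfolding q(2)[symmetric] real_sqrt_divide real_sqrt_mult ..
    also have "\<dots> = 4 * sqrt 2 / (sqrt (n - 1) * sqrt (n + 2))"
      using q(1) by (rule cancel)
    finally show ?thesis
      by (simp only: real_sqrt_mult)
  qed
  finally show ?thesis
    by (simp add: m_def)
qed

end

theorem mainTheorem6:
  fixes M :: "'a measure" and N :: "'b measure"
    and X :: "'a \<Rightarrow> real^'n" and Z :: "'b \<Rightarrow> real" and \<theta> :: "real^'n"
  assumes "CARD('n) \<ge> 2"
    and "prob_space M" and "X \<in> borel_measurable M"
    and "distr M borel X = uniform_sphere (sqrt (real CARD('n)))"
    and "norm \<theta> = 1"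
    and "prob_space N" and "Z \<in> borel_measurable N"
    and "distr N borel Z = density lborel std_normal_density"
  shows "dTV M (\<lambda>\<omega>. X \<omega> \<bullet> \<theta>) N Z
           \<le> 2 * sqrt 2 / sqrt ((real CARD('n) - 1) * (real CARD('n) + 2))"
proof -
  let ?n = "real CARD('n)"
  let ?G = "{g :: real \<Rightarrow> real. continuous_on UNIV g \<and> (\<forall>x. \<bar>g x\<bar> \<le> 1)}"
  have "\<bar>(\<integral>\<omega>. g (X \<omega> \<bullet> \<theta>) \<partial>M) - (\<integral>\<omega>. g (Z \<omega>) \<partial>N)\<bar> \<le> 4 * sqrt 2 / sqrt ((?n - 1) * (?n + 2))"
    if "g \<in> ?G" for g
  proof -
    from that have g: "continuous_on UNIV g" "\<And>x. \<bar>g x\<bar> \<le> 1" by auto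
    have [measurable]: "g \<in> borel_measurable borel"
      using g(1) by (rule borel_measurable_continuous_onI)
    have "(\<integral>\<omega>. g (X \<omega> \<bullet> \<theta>) \<partial>M) = (\<integral>x. g (x \<bullet> \<theta>) \<partial>distr M borel X)"
      using assms(3) by (subst integral_distr) auto
    moreover have "(\<integral>\<omega>. g (Z \<omega>) \<partial>N) = (\<integral>x. g x \<partial>distr N borel Z)"
      using assms(7) by (subst integral_distr) auto
    moreover have "\<dots> = (\<integral>x. std_normal_density x * g x \<partial>lborel)"
      unfolding assms(8) by (subst integral_density) auto
    ultimately show ?thesis
      using sphere_coordinate_gaussian_comparison[of \<theta> ?n g] assms(1,4,5) g by simp
  qed
  moreover have "(\<lambda>_. 0) \<in> ?G" by simp
  ultimately have "(SUP g\<in>?G. \<bar>(\<integral>\<omega>. g (X \<omega> \<bullet> \<theta>) \<partial>M) - (\<integral>\<omega>. g (Z \<omega>) \<partial>N)\<bar>)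
      \<le> 4 * sqrt 2 / sqrt ((?n - 1) * (?n + 2))"
    by (intro cSUP_least) blast+
  then show ?thesis
    by (simp add: dTV_def)
qed

end
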